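(* Let $(\Phi,h)$ be a finitely list-weighted gain graph with $n$ vertices. Then the number of proper list colorations of $(\Phi,h)$ equals $(-1)^nQ_{(\Phi,h)}(\mathbf{u},-1,0)$ evaluated at $u_{k}=-|k|$ for every finite $k\subseteq\mathfrak{C}$.
   Context: $\Phi$ is a gain graph on a finite graph with vertex set $V=\{v_1,\dots,v_n\}$ and edge set $E$ (links, loops, half edges, loose edges allowed), lattice-ordered gain group $\mathfrak{G}$, gains on links and loops with $\varphi(e^{-1})=\varphi(e)^{-1}$; a loose edge is treated as a loop of gain $1$. An edge set is balanced if it has no half edges and all circles in it have gain $1$. For $S\subseteq E$: $c(S)$ is the number of connected components of $(V,S)$, $b(S)$ the number of balanced ones, $\pi_b(S)$ their vertex sets. For a balanced component with vertex set $W$ and $v\in W$, $\eta_S(v)=\bigvee_{w\in W}\varphi(S_{vw})$, $S_{vw}$ any path in $S$ from $v$ to $w$. The color set $\mathfrak{C}$ carries a fixed-point-free right action of $\mathfrak{G}$. Finitely list weighted means each weight $h_i=h(v_i)$ is a finite subset of $\mathfrak{C}$; the weight semigroup is the finite subsets of $\mathfrak{C}$ under intersection, and $h/S(W)=\bigcap_{v_i\in W}h_i\eta_S(v_i)$. A proper list coloration is $x:V\to\mathfrak{C}$ with $x_i\in h_i$ and $x_j\ne x_i\varphi(e_{ij})$ for every link or loop $e_{ij}$ (balanced loops and loose edges are always improper). The total dichromatic polynomial, with indeterminates $u_k$ (one per finite $k\subseteq\mathfrak{C}$), $v$, $z$, is $Q_{(\Phi,h)}(\mathbf{u},v,z)=\sum_{S\subseteq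 E}v^{|S|-n+b(S)}z^{c(S)-b(S)}\prod_{W\in\pi_b(S)}u_{h/S(W)}$, with $0^0=1$. *)

theory Defs
  imports Main "HOL-Library.FuncSet" "HOL-Library.Poly_Mapping"
begin

text \<open>Gain groups need not be commutative. They are written additively, on top of the class
  \<^class>\<open>group_add\<close>: the identity is \<open>0\<close> and the inverse of \<open>g\<close> is \<open>- g\<close>.\<close>

class lattice_group_add = group_add + lattice +
  assumes lattice_group_add_left_mono: "a \<le> b \<Longrightarrow> c + a \<le> c + b"
    and lattice_group_add_right_mono: "a \<le> b \<Longrightarrow> a + c \<le> b + c"

text \<open>\<open>Joins v w\<close> is a link if \<open>v \<noteq> w\<close> and a loop if \<open>v = w\<close>. The order of \<open>v\<close> and \<open>w\<close> only
  fixes a reference direction.\<close>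

datatype 'v edge_ends = Joins 'v 'v | Half 'v | Loose

fun end_set :: "'v edge_ends \<Rightarrow> 'v set" where
  "end_set (Joins v w) = {v, w}"
| "end_set (Half v) = {v}"
| "end_set Loose = {}"

text \<open>An oriented edge is a pair \<open>(e, b)\<close>: the edge \<open>e\<close> in its reference direction if \<open>b\<close> holds,
  its inverse otherwise. The gain of \<open>(e, b)\<close> is meaningful only if \<open>e\<close> is a link or loop.\<close>

record ('v, 'e, 'g) pre_gain_graph =
  verts :: "'v set"
  edges :: "'e set"
  ends :: "'e \<Rightarrow> 'v edge_ends"
  gain :: "'e \<times> bool \<Rightarrow> 'g"

definition ordinary_edge :: "('v, 'e, 'g) pre_gain_graph \<Rightarrow> 'e \<Rightarrow> bool" where
  "ordinary_edge \<Phi> e \<longleftrightarrow> (\<exists>v w. ends \<Phi> e = Joins v w)"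

locale gain_graph =
  fixes \<Phi> :: "('v, 'e, 'g::lattice_group_add) pre_gain_graph"
  assumes finite_verts: "finite (verts \<Phi>)"
    and finite_edges: "finite (edges \<Phi>)"
    and ends_in_verts: "e \<in> edges \<Phi> \<Longrightarrow> end_set (ends \<Phi> e) \<subseteq> verts \<Phi>"
    and gain_inverse:
      "e \<in> edges \<Phi> \<Longrightarrow> ordinary_edge \<Phi> e \<Longrightarrow> gain \<Phi> (e, \<not> b) = - gain \<Phi> (e, b)"

fun tail :: "('v, 'e, 'g) pre_gain_graph \<Rightarrow> 'e \<times> bool \<Rightarrow> 'v" where
  "tail \<Phi> (e, b) = (case ends \<Phi> e of Joins v w \<Rightarrow> if b then v else w)"

fun head :: "('v, 'e, 'g) pre_gain_graph \<Rightarrow> 'e \<times> bool \<Rightarrow> 'v" where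
  "head \<Phi> (e, b) = (case ends \<Phi> e of Joins v w \<Rightarrow> if b then w else v)"

fun walk :: "('v, 'e, 'g) pre_gain_graph \<Rightarrow> 'e set \<Rightarrow> 'v \<Rightarrow> ('e \<times> bool) list \<Rightarrow> 'v \<Rightarrow> bool" where
  "walk \<Phi> S v [] w \<longleftrightarrow> v = w"
| "walk \<Phi> S v (d # ds) w \<longleftrightarrow>
     fst d \<in> S \<and> ordinary_edge \<Phi> (fst d) \<and> tail \<Phi> d = v \<and> walk \<Phi> S (head \<Phi> d) ds w"

definition walk_gain :: "('v, 'e, 'g::monoid_add) pre_gain_graph \<Rightarrow> ('e \<times> bool) list \<Rightarrow> 'g" where
  "walk_gain \<Phi> ds = sum_list (map (gain \<Phi>) ds)"

definition path :: "('v, 'e, 'g) pre_gain_graph \<Rightarrow> 'e set \<Rightarrow> 'v \<Rightarrow> ('e \<times> bool) list \<Rightarrow> 'v \<Rightarrow> bool" where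
  "path \<Phi> S v ds w \<longleftrightarrow> walk \<Phi> S v ds w \<and> distinct (v # map (head \<Phi>) ds)"

text \<open>A circle with a chosen initial vertex and direction. Distinctness of the edges rules out
  going back and forth along a single link. Whether the gain is \<open>0\<close> does not depend on the
  choices.\<close>

definition circle :: "('v, 'e, 'g) pre_gain_graph \<Rightarrow> 'e set \<Rightarrow> ('e \<times> bool) list \<Rightarrow> bool" where
  "circle \<Phi> S ds \<longleftrightarrow>
     ds \<noteq> [] \<and> (\<exists>v. walk \<Phi> S v ds v) \<and> distinct (map (tail \<Phi>) ds) \<and> distinct (map fst ds)"

text \<open>A loose edge counts as a loop with gain \<open>0\<close> and so never destroys balance.\<close>

definition balanced :: "('v, 'e, 'g::monoid_add) pre_gain_graph \<Rightarrow> 'e set \<Rightarrow> bool" where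
  "balanced \<Phi> S \<longleftrightarrow>
     (\<forall>e\<in>S. \<forall>v. ends \<Phi> e \<noteq> Half v) \<and> (\<forall>ds. circle \<Phi> S ds \<longrightarrow> walk_gain \<Phi> ds = 0)"

text \<open>Components are represented by their vertex sets; a loose edge is not a component.\<close>

definition components :: "('v, 'e, 'g) pre_gain_graph \<Rightarrow> 'e set \<Rightarrow> 'v set set" where
  "components \<Phi> S =
     verts \<Phi> // {(v, w). v \<in> verts \<Phi> \<and> w \<in> verts \<Phi> \<and> (\<exists>ds. walk \<Phi> S v ds w)}"

definition component_edges :: "('v, 'e, 'g) pre_gain_graph \<Rightarrow> 'e set \<Rightarrow> 'v set \<Rightarrow> 'e set" where
  "component_edges \<Phi> S W = {e \<in> S. end_set (ends \<Phi> e) \<inter> W \<noteq> {}}"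

definition balanced_components ::
  "('v, 'e, 'g::monoid_add) pre_gain_graph \<Rightarrow> 'e set \<Rightarrow> 'v set set" where
  "balanced_components \<Phi> S = {W \<in> components \<Phi> S. balanced \<Phi> (component_edges \<Phi> S W)}"

text \<open>In a balanced component all paths from \<open>v\<close> to \<open>w\<close> have the same gain, so the choice made
  by \<open>SOME\<close> is immaterial there.\<close>

definition path_gain :: "('v, 'e, 'g::monoid_add) pre_gain_graph \<Rightarrow> 'e set \<Rightarrow> 'v \<Rightarrow> 'v \<Rightarrow> 'g" where
  "path_gain \<Phi> S v w = walk_gain \<Phi> (SOME ds. path \<Phi> S v ds w)"

definition eta ::
  "('v, 'e, 'g::lattice_group_add) pre_gain_graph \<Rightarrow> 'e set \<Rightarrow> 'v set \<Rightarrow> 'v \<Rightarrow> 'g" where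
  "eta \<Phi> S W v = Sup_fin (path_gain \<Phi> S v ` W)"

locale fixed_point_free_right_action =
  fixes C :: "'c set" and act :: "'c \<Rightarrow> 'g::group_add \<Rightarrow> 'c"
  assumes act_closed: "c \<in> C \<Longrightarrow> act c g \<in> C"
    and act_zero: "c \<in> C \<Longrightarrow> act c 0 = c"
    and act_add: "c \<in> C \<Longrightarrow> act c (g + g') = act (act c g) g'"
    and act_fixed_point_free: "c \<in> C \<Longrightarrow> act c g = c \<Longrightarrow> g = 0"

definition finite_list_weight ::
  "('v, 'e, 'g) pre_gain_graph \<Rightarrow> 'c set \<Rightarrow> ('v \<Rightarrow> 'c set) \<Rightarrow> bool" where
  "finite_list_weight \<Phi> C h \<longleftrightarrow> (\<forall>v\<in>verts \<Phi>. finite (h v) \<and> h v \<subseteq> C)"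

definition contracted_weight ::
  "('v, 'e, 'g::lattice_group_add) pre_gain_graph \<Rightarrow> ('c \<Rightarrow> 'g \<Rightarrow> 'c) \<Rightarrow> ('v \<Rightarrow> 'c set) \<Rightarrow>
   'e set \<Rightarrow> 'v set \<Rightarrow> 'c set" where
  "contracted_weight \<Phi> act h S W = (\<Inter>v\<in>W. (\<lambda>c. act c (eta \<Phi> S W v)) ` h v)"

definition improper_edge ::
  "('v, 'e, 'g) pre_gain_graph \<Rightarrow> ('c \<Rightarrow> 'g \<Rightarrow> 'c) \<Rightarrow> ('v \<Rightarrow> 'c) \<Rightarrow> 'e \<Rightarrow> bool" where
  "improper_edge \<Phi> act x e \<longleftrightarrow> (case ends \<Phi> e of
      Joins v w \<Rightarrow> \<exists>b. x (head \<Phi> (e, b)) = act (x (tail \<Phi> (e, b))) (gain \<Phi> (e, b))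
    | Half v \<Rightarrow> False
    | Loose \<Rightarrow> True)"

definition proper_list_colorations ::
  "('v, 'e, 'g) pre_gain_graph \<Rightarrow> 'c set \<Rightarrow> ('c \<Rightarrow> 'g \<Rightarrow> 'c) \<Rightarrow> ('v \<Rightarrow> 'c set) \<Rightarrow> ('v \<Rightarrow> 'c) set" where
  "proper_list_colorations \<Phi> C act h =
     {x \<in> verts \<Phi> \<rightarrow>\<^sub>E C. (\<forall>v\<in>verts \<Phi>. x v \<in> h v) \<and> (\<forall>e\<in>edges \<Phi>. \<not> improper_edge \<Phi> act x e)}"

text \<open>Polynomials with integer coefficients in indeterminates of type \<open>'x\<close> are finitely supported
  functions on monomials, and monomials are finitely supported exponent functions.\<close>

type_synonym 'x int_mpoly = "('x \<Rightarrow>\<^sub>0 nat) \<Rightarrow>\<^sub>0 int"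

definition Var :: "'x \<Rightarrow> 'x int_mpoly" where
  "Var x = Poly_Mapping.single (Poly_Mapping.single x 1) 1"

definition eval_mpoly :: "('x \<Rightarrow> 'a::comm_ring_1) \<Rightarrow> 'x int_mpoly \<Rightarrow> 'a" where
  "eval_mpoly \<alpha> p =
     (\<Sum>m\<in>Poly_Mapping.keys p. of_int (Poly_Mapping.lookup p m) *
        (\<Prod>x\<in>Poly_Mapping.keys m. \<alpha> x ^ Poly_Mapping.lookup m x))"

text \<open>\<open>Ind_u k\<close> is meant for finite sets \<open>k\<close> of colors; no others occur in the polynomial below.\<close>

datatype 'c indeterminate = Ind_u "'c set" | Ind_v | Ind_z

fun values_at :: "('c set \<Rightarrow> 'a) \<Rightarrow> 'a \<Rightarrow> 'a \<Rightarrow> 'c indeterminate \<Rightarrow> 'a" where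
  "values_at u v z (Ind_u k) = u k"
| "values_at u v z Ind_v = v"
| "values_at u v z Ind_z = z"

text \<open>The subtractions of natural numbers in the exponents do not truncate: a balanced component
  on \<open>W\<close> has at least \<open>card W - 1\<close> edges, an unbalanced one at least \<open>card W\<close>.\<close>

definition total_dichromatic ::
  "('v, 'e, 'g::lattice_group_add) pre_gain_graph \<Rightarrow> ('c \<Rightarrow> 'g \<Rightarrow> 'c) \<Rightarrow> ('v \<Rightarrow> 'c set) \<Rightarrow>
   'c indeterminate int_mpoly" where
  "total_dichromatic \<Phi> act h =
     (\<Sum>S\<in>Pow (edges \<Phi>).
        Var Ind_v ^ (card S + card (balanced_components \<Phi> S) - card (verts \<Phi>)) *
        Var Ind_z ^ (card (components \<Phi> S) - card (balanced_components \<Phi> S)) *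
        (\<Prod>W\<in>balanced_components \<Phi> S. Var (Ind_u (contracted_weight \<Phi> act h S W))))"

end

theory Submission
  imports Defs
begin

text \<open>By inclusion and exclusion, the number of proper list colorations is the sum over all edge
  sets \<open>S\<close> of \<open>(-1)\<^bsup>|S|\<^esup>\<close> times the number of list colorations for which every edge of \<open>S\<close> is
  improper. If \<open>S\<close> is unbalanced there are none, since the action has no fixed points, and the
  term of \<open>S\<close> in the polynomial vanishes at \<open>z = 0\<close>. If \<open>S\<close> is balanced, such a coloration is
  determined by one color \<open>x\<^sub>v \<eta>\<^sub>S(v)\<close> per component \<open>W\<close>, which ranges over \<open>h/S(W)\<close>.
  The signs agree because \<open>n \<le> |S| + c(S)\<close>.\<close>

section \<open>Evaluation of polynomials\<close>

lemma eval_mpoly_zero [simp]: "eval_mpoly \<alpha> 0 = 0"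
  by (simp add: eval_mpoly_def)

lemma eval_mpoly_add: "eval_mpoly \<alpha> (p + q) = eval_mpoly \<alpha> p + eval_mpoly \<alpha> q"
  unfolding eval_mpoly_def by (rule setsum_keys_plus_distrib) (simp_all add: algebra_simps)

lemma eval_mpoly_sum: "eval_mpoly \<alpha> (\<Sum>i\<in>I. p i) = (\<Sum>i\<in>I. eval_mpoly \<alpha> (p i))"
  by (induction I rule: infinite_finite_induct) (auto simp: eval_mpoly_add)

lemma eval_mpoly_single:
  "eval_mpoly \<alpha> (Poly_Mapping.single m a) =
    of_int a * (\<Prod>x\<in>Poly_Mapping.keys m. \<alpha> x ^ Poly_Mapping.lookup m x)"
  by (simp add: eval_mpoly_def)

text \<open>Keys outside a support contribute a factor \<open>\<alpha> x ^ 0 = 1\<close>, so all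
  three products can be taken over the union of the two supports, where exponents add.\<close>

lemma eval_monomial_add:
  fixes \<alpha> :: "'x \<Rightarrow> 'a::comm_ring_1"
  shows "(\<Prod>x\<in>Poly_Mapping.keys (m + n). \<alpha> x ^ Poly_Mapping.lookup (m + n) x) =
    (\<Prod>x\<in>Poly_Mapping.keys m. \<alpha> x ^ Poly_Mapping.lookup m x) *
    (\<Prod>x\<in>Poly_Mapping.keys n. \<alpha> x ^ Poly_Mapping.lookup n x)"
proof -
  let ?K = "Poly_Mapping.keys m \<union> Poly_Mapping.keys n"
  have *: "(\<Prod>x\<in>Poly_Mapping.keys k. \<alpha> x ^ Poly_Mapping.lookup k x) =
      (\<Prod>x\<in>?K. \<alpha> x ^ Poly_Mapping.lookup k x)" if "Poly_Mapping.keys k \<subseteq> ?K" for k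
    by (rule prod.mono_neutral_left) (use that in \<open>auto simp: in_keys_iff\<close>)
  show ?thesis
    by (subst (1 2 3) *) (use keys_add[of m n] in \<open>auto simp: lookup_add power_add prod.distrib\<close>)
qed

text \<open>Setting the value at a fresh key amounts to adding a single term. In this form the
  induction suits additive maps such as \<open>eval_mpoly\<close>.\<close>

lemma poly_mapping_single_induct [case_names zero add_single]:
  fixes p :: "'k \<Rightarrow>\<^sub>0 'b::comm_monoid_add"
  assumes "P 0" "\<And>m a p. P p \<Longrightarrow> P (Poly_Mapping.single m a + p)"
  shows "P p"
proof (induction p rule: update_induct)
  case const
  then show ?case
    using assms(1) .
next
  case (update f a b)
  have "Poly_Mapping.update a b f = Poly_Mapping.single a b + f"
    using update(1) by (intro poly_mapping_eqI)
      (auto simp: lookup_update lookup_add lookup_single when_def in_keys_iff)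
  with update assms(2) show ?case
    by metis
qed

text \<open>Both sides are additive in \<open>p\<close> and in \<open>q\<close>, so two nested
  inductions reduce the claim to a product of two single terms.\<close>

lemma eval_mpoly_mult: "eval_mpoly \<alpha> (p * q) = eval_mpoly \<alpha> p * eval_mpoly \<alpha> q"
proof (induction p rule: poly_mapping_single_induct)
  case zero
  show ?case by simp
next
  case (add_single m a p)
  have "eval_mpoly \<alpha> (Poly_Mapping.single m a * q) =
      eval_mpoly \<alpha> (Poly_Mapping.single m a) * eval_mpoly \<alpha> q"
    by (induction q rule: poly_mapping_single_induct)
      (auto simp: eval_mpoly_add mult_single eval_mpoly_single eval_monomial_add
        algebra_simps)
  with add_single show ?case
    by (simp add: ring_distribs eval_mpoly_add)
qed

lemma eval_mpoly_one [simp]: "eval_mpoly \<alpha> 1 = 1"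
  by (simp add: single_one[symmetric] eval_mpoly_single del: single_one)

lemma eval_mpoly_Var [simp]: "eval_mpoly \<alpha> (Var x) = \<alpha> x"
  by (simp add: Var_def eval_mpoly_single)

lemma eval_mpoly_power: "eval_mpoly \<alpha> (p ^ n) = eval_mpoly \<alpha> p ^ n"
  by (induction n) (auto simp: eval_mpoly_mult)

lemma eval_mpoly_prod: "eval_mpoly \<alpha> (\<Prod>i\<in>I. p i) = (\<Prod>i\<in>I. eval_mpoly \<alpha> (p i))"
  by (induction I rule: infinite_finite_induct) (auto simp: eval_mpoly_mult)

section \<open>Lattice-ordered groups\<close>

text \<open>Left translation by \<open>c\<close> is monotone with monotone inverse, translation by
  \<open>- c\<close>. It is thus an order automorphism and preserves joins.\<close>

lemma sup_add_left:
  fixes a b c :: "'g::lattice_group_add"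
  shows "c + sup a b = sup (c + a) (c + b)"
proof (rule antisym)
  have "a \<le> - c + sup (c + a) (c + b)" "b \<le> - c + sup (c + a) (c + b)"
    using lattice_group_add_left_mono[of "c + a" "sup (c + a) (c + b)" "- c"]
      lattice_group_add_left_mono[of "c + b" "sup (c + a) (c + b)" "- c"]
    by (simp_all add: add.assoc[symmetric])
  then have "sup a b \<le> - c + sup (c + a) (c + b)"
    by simp
  from lattice_group_add_left_mono[OF this, of c]
  show "c + sup a b \<le> sup (c + a) (c + b)"
    by (simp add: add.assoc[symmetric])
next
  show "sup (c + a) (c + b) \<le> c + sup a b"
    by (intro sup_least lattice_group_add_left_mono sup_ge1 sup_ge2)
qed

lemma Sup_fin_add_left:
  fixes c :: "'g::lattice_group_add"
  assumes "finite A" "A \<noteq> {}"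
  shows "c + Sup_fin A = Sup_fin ((+) c ` A)"
  using Sup_fin.hom_commute[where h = "(+) c", OF sup_add_left assms] .

section \<open>Walks and balance\<close>

text \<open>Used to cut a closed walk at a repeated tail or a repeated edge.\<close>

lemma not_distinct_map_decomp:
  assumes "\<not> distinct (map f ds)"
  shows "\<exists>xs a ys b zs. ds = xs @ a # ys @ b # zs \<and> f a = f b"
proof -
  obtain us y vs ws where "map f ds = us @ y # vs @ y # ws"
    using not_distinct_decomp[OF assms] by auto
  then show ?thesis
    by (fastforce simp: map_eq_append_conv append_eq_map_conv map_eq_Cons_conv Cons_eq_map_conv)
qed

lemma walk_append:
  "walk \<Phi> S v (xs @ ys) w \<longleftrightarrow> (\<exists>u. walk \<Phi> S v xs u \<and> walk \<Phi> S u ys w)"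
  by (induction xs arbitrary: v) auto

lemma walk_gain_simps [simp]:
  "walk_gain \<Phi> [] = 0"
  "walk_gain \<Phi> (d # ds) = gain \<Phi> d + walk_gain \<Phi> ds"
  "walk_gain \<Phi> (xs @ ys) = walk_gain \<Phi> xs + walk_gain \<Phi> ys"
  by (simp_all add: walk_gain_def)

lemma walk_mono: "walk \<Phi> S v ds w \<Longrightarrow> S \<subseteq> T \<Longrightarrow> walk \<Phi> T v ds w"
  by (induction ds arbitrary: v) auto

lemma balanced_mono: "balanced \<Phi> T \<Longrightarrow> S \<subseteq> T \<Longrightarrow> balanced \<Phi> S"
  unfolding balanced_def circle_def by (meson subsetD walk_mono)

lemma tail_flip: "ordinary_edge \<Phi> e \<Longrightarrow> tail \<Phi> (e, \<not> b) = head \<Phi> (e, b)"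
  and head_flip: "ordinary_edge \<Phi> e \<Longrightarrow> head \<Phi> (e, \<not> b) = tail \<Phi> (e, b)"
  by (auto simp: ordinary_edge_def)

lemma tail_in_end_set: "ordinary_edge \<Phi> e \<Longrightarrow> tail \<Phi> (e, b) \<in> end_set (ends \<Phi> e)"
  and head_in_end_set: "ordinary_edge \<Phi> e \<Longrightarrow> head \<Phi> (e, b) \<in> end_set (ends \<Phi> e)"
  by (auto simp: ordinary_edge_def)

text \<open>Loop erasure: a path from the head of the first edge either avoids \<open>v\<close> and
  can be extended by that edge, or meets \<open>v\<close>, and then the part after \<open>v\<close>
  is the required path.\<close>

lemma walk_imp_path:
  assumes "walk \<Phi> S v ds w"
  shows "\<exists>ds'. path \<Phi> S v ds' w"
  using assms
proof (induction ds arbitrary: v)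
  case Nil
  then show ?case
    by (intro exI[of _ "[]"]) (simp add: path_def)
next
  case (Cons d ds)
  then obtain ps where ps: "path \<Phi> S (head \<Phi> d) ps w"
    by auto
  show ?case
  proof (cases "v \<in> set (head \<Phi> d # map (head \<Phi>) ps)")
    case False
    with ps Cons.prems show ?thesis
      by (intro exI[of _ "d # ps"]) (simp add: path_def)
  next
    case True
    show ?thesis
    proof (cases "v = head \<Phi> d")
      case True
      with ps show ?thesis by blast
    next
      case False
      with True obtain xs c ys where *: "ps = xs @ c # ys" "v = head \<Phi> c"
        by (auto dest: split_list)
      with ps have "path \<Phi> S v ys w"
        by (auto simp: path_def walk_append)
      then show ?thesis by blast
    qed
  qed
qed

text \<open>The gain of a closed walk is the sum of gains of shorter closed walks inserted into each
  other, until only circles and backtracking pairs remain.\<close>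

lemma (in gain_graph) closed_walk_gain_zero:
  assumes "balanced \<Phi> S" "S \<subseteq> edges \<Phi>" "walk \<Phi> S v ds v"
  shows "walk_gain \<Phi> ds = 0"
  using assms(3)
proof (induction "length ds" arbitrary: v ds rule: less_induct)
  case less
  consider "ds = []" | "circle \<Phi> S ds" | "\<not> distinct (map (tail \<Phi>) ds)"
    | "distinct (map (tail \<Phi>) ds)" "\<not> distinct (map fst ds)"
    using less.prems by (auto simp: circle_def)
  then show ?case
  proof cases
    case 1
    then show ?thesis by simp
  next
    case 2
    then show ?thesis
      using assms(1) by (simp add: balanced_def)
  next
    case 3
    \<comment> \<open>The walk returns at \<open>b\<close> to the tail of \<open>a\<close>, so
      \<open>a # ys\<close> is a closed walk. Both it and the rest are shorter, and deleting a block
      of gain \<open>0\<close> in place is valid without commuting any gains.\<close>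
    then obtain xs a ys b zs where ds: "ds = xs @ a # ys @ b # zs" "tail \<Phi> a = tail \<Phi> b"
      by (blast dest: not_distinct_map_decomp)
    from less.prems have "walk \<Phi> S (tail \<Phi> a) (a # ys) (tail \<Phi> a)" "walk \<Phi> S v (xs @ b # zs) v"
      using ds(2) by (auto simp: ds(1) walk_append)
    then have "walk_gain \<Phi> (a # ys) = 0" "walk_gain \<Phi> (xs @ b # zs) = 0"
      by (auto intro!: less.hyps simp: ds(1) simp del: walk_gain_simps walk.simps)
    then show ?thesis
      by (simp add: ds(1) add.assoc[symmetric])
  next
    case 4
    then obtain xs a ys b zs where ds: "ds = xs @ a # ys @ b # zs" "fst a = fst b"
      by (blast dest: not_distinct_map_decomp)
    \<comment> \<open>Distinct tails force the two passages through the common edge to be in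
      opposite directions. Hence \<open>ys\<close> is closed at the head of \<open>a\<close>, and
      once its gain is \<open>0\<close> the gains of \<open>a\<close> and \<open>b\<close>
      cancel.\<close>
    with 4 have "a \<noteq> b" by auto
    then have b: "b = (fst a, \<not> snd a)"
      using ds(2) by (cases a; cases b) auto
    have a: "fst a \<in> S" "ordinary_edge \<Phi> (fst a)"
      using less.prems by (auto simp: ds(1) walk_append)
    then have flip: "tail \<Phi> b = head \<Phi> a" "head \<Phi> b = tail \<Phi> a" "gain \<Phi> b = - gain \<Phi> a"
      using tail_flip[of \<Phi> "fst a" "snd a"] head_flip[of \<Phi> "fst a" "snd a"]
        gain_inverse[of "fst a" "snd a"] assms(2) by (auto simp: b)
    with less.prems have "walk \<Phi> S (head \<Phi> a) ys (head \<Phi> a)" "walk \<Phi> S v (xs @ zs) v"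
      by (auto simp: ds(1) walk_append)
    then have "walk_gain \<Phi> ys = 0" "walk_gain \<Phi> (xs @ zs) = 0"
      by (auto intro!: less.hyps simp: ds(1) simp del: walk_gain_simps walk.simps)
    then show ?thesis
      by (simp add: ds(1) flip(3))
  qed
qed

section \<open>Connectedness as an equivalence relation; components and their balance\<close>

definition connection :: "('v, 'e, 'g) pre_gain_graph \<Rightarrow> 'e set \<Rightarrow> ('v \<times> 'v) set" where
  "connection \<Phi> S = {(v, w). v \<in> verts \<Phi> \<and> w \<in> verts \<Phi> \<and> (\<exists>ds. walk \<Phi> S v ds w)}"

lemma components_eq_quotient: "components \<Phi> S = verts \<Phi> // connection \<Phi> S"
  by (simp add: components_def connection_def)

lemma walk_reverse:
  assumes "walk \<Phi> S v ds w"
  shows "\<exists>ds'. walk \<Phi> S w ds' v"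
  using assms
proof (induction ds arbitrary: v)
  case Nil
  then show ?case
    by (intro exI[of _ "[]"]) simp
next
  case (Cons d ds)
  obtain e b where d: "d = (e, b)" by (cases d)
  from Cons obtain ds' where "walk \<Phi> S w ds' (head \<Phi> d)"
    by auto
  with Cons.prems have "walk \<Phi> S w (ds' @ [(e, \<not> b)]) v"
    using tail_flip[of \<Phi> e b] head_flip[of \<Phi> e b]
    by (auto simp: d walk_append simp del: tail.simps head.simps)
  then show ?case by blast
qed

lemma equiv_connection: "equiv (verts \<Phi>) (connection \<Phi> S)"
proof (rule equivI)
  show "refl_on (verts \<Phi>) (connection \<Phi> S)"
    by (auto simp: refl_on_def connection_def intro: exI[of _ "[]"])
  show "sym (connection \<Phi> S)"
    by (auto simp: sym_def connection_def intro: walk_reverse)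
  show "trans (connection \<Phi> S)"
    unfolding trans_def connection_def using walk_append[of \<Phi> S] by blast
qed (auto simp: connection_def)

lemma component_of_in_components: "v \<in> verts \<Phi> \<Longrightarrow> connection \<Phi> S `` {v} \<in> components \<Phi> S"
  unfolding components_eq_quotient by (rule quotientI)

lemma component_eq:
  assumes "W \<in> components \<Phi> S" "v \<in> W"
  shows "W = connection \<Phi> S `` {v}"
  using assms equiv_connection[of \<Phi> S] unfolding components_eq_quotient
  by (auto elim!: quotientE simp: equiv_class_eq_iff)

lemma component_subset: "W \<in> components \<Phi> S \<Longrightarrow> W \<subseteq> verts \<Phi>"
  unfolding components_eq_quotient by (auto elim!: quotientE simp: connection_def)

lemma component_nonempty: "W \<in> components \<Phi> S \<Longrightarrow> W \<noteq> {}"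
  unfolding components_eq_quotient by (rule in_quotient_imp_non_empty[OF equiv_connection])

lemma walk_between_component:
  assumes "W \<in> components \<Phi> S" "v \<in> W" "w \<in> W"
  shows "\<exists>ds. walk \<Phi> S v ds w"
  using component_eq[OF assms(1,2)] assms(3) by (auto simp: connection_def)

context gain_graph
begin

lemma tail_in_verts: "fst d \<in> edges \<Phi> \<Longrightarrow> ordinary_edge \<Phi> (fst d) \<Longrightarrow> tail \<Phi> d \<in> verts \<Phi>"
  and head_in_verts: "fst d \<in> edges \<Phi> \<Longrightarrow> ordinary_edge \<Phi> (fst d) \<Longrightarrow> head \<Phi> d \<in> verts \<Phi>"
  using ends_in_verts[of "fst d"] tail_in_end_set[of \<Phi> "fst d" "snd d"]
    head_in_end_set[of \<Phi> "fst d" "snd d"] by auto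

lemma walk_in_verts:
  assumes "S \<subseteq> edges \<Phi>" "v \<in> verts \<Phi>" "walk \<Phi> S v ds w"
  shows "w \<in> verts \<Phi>"
  using assms(2,3)
  by (induction ds arbitrary: v) (use assms(1) head_in_verts in auto)

lemma finite_components: "finite (components \<Phi> S)"
  by (rule finite_subset[of _ "Pow (verts \<Phi>)"]) (auto dest: component_subset simp: finite_verts)

lemma walk_in_component:
  assumes "S \<subseteq> edges \<Phi>" "W \<in> components \<Phi> S" "v \<in> W" "walk \<Phi> S v ds w"
  shows "w \<in> W"
  using component_eq[OF assms(2,3)] component_subset[OF assms(2)] walk_in_verts[OF assms(1) _ assms(4)]
    assms(3,4) by (auto simp: connection_def)

text \<open>A walk that starts in \<open>W\<close> never leaves \<open>W\<close>, so each of its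
  edges has its tail in \<open>W\<close>.\<close>

lemma walk_component_edges:
  assumes "S \<subseteq> edges \<Phi>" "W \<in> components \<Phi> S" "v \<in> W" "walk \<Phi> S v ds w"
  shows "walk \<Phi> (component_edges \<Phi> S W) v ds w"
  using assms(3,4)
proof (induction ds arbitrary: v)
  case Nil
  then show ?case by simp
next
  case (Cons d ds)
  from Cons.prems have "walk \<Phi> S v [d] (head \<Phi> d)"
    by simp
  then have "head \<Phi> d \<in> W"
    by (rule walk_in_component[OF assms(1,2) Cons.prems(1)])
  moreover have "fst d \<in> component_edges \<Phi> S W"
    using Cons.prems tail_in_end_set[of \<Phi> "fst d" "snd d"]
    by (auto simp: component_edges_def simp del: tail.simps head.simps)
  ultimately show ?case
    using Cons by simp
qed

text \<open>A half edge or a circle lies within the component of any of its vertices, so an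
  obstruction to balance shows up in a single component. Loose edges belong to no component but
  never obstruct. This identifies the edge sets for which the exponent of \<open>Ind_z\<close> is
  zero.\<close>

lemma balanced_iff_all_components_balanced:
  assumes "S \<subseteq> edges \<Phi>"
  shows "balanced \<Phi> S \<longleftrightarrow> balanced_components \<Phi> S = components \<Phi> S"
proof
  assume "balanced \<Phi> S"
  then have "balanced \<Phi> (component_edges \<Phi> S W)" for W
    by (rule balanced_mono) (auto simp: component_edges_def)
  then show "balanced_components \<Phi> S = components \<Phi> S"
    by (simp add: balanced_components_def)
next
  assume all: "balanced_components \<Phi> S = components \<Phi> S"
  have comp: "balanced \<Phi> (component_edges \<Phi> S (connection \<Phi> S `` {v}))"
      "v \<in> connection \<Phi> S `` {v}" if "v \<in> verts \<Phi>" for v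
  proof -
    show "balanced \<Phi> (component_edges \<Phi> S (connection \<Phi> S `` {v}))"
      using component_of_in_components[OF that, of S] all by (auto simp: balanced_components_def)
    show "v \<in> connection \<Phi> S `` {v}"
      by (rule equiv_class_self[OF equiv_connection that])
  qed
  show "balanced \<Phi> S"
    unfolding balanced_def
  proof (intro conjI ballI allI impI notI)
    fix e v assume e: "e \<in> S" "ends \<Phi> e = Half v"
    then have v: "v \<in> verts \<Phi>"
      using ends_in_verts[of e] assms by auto
    with e comp(2)[OF v] have "e \<in> component_edges \<Phi> S (connection \<Phi> S `` {v})"
      by (auto simp: component_edges_def)
    with comp(1)[OF v] e(2) show False
      by (auto simp: balanced_def)
  next
    fix ds assume ds: "circle \<Phi> S ds"
    then obtain v where v: "walk \<Phi> S v ds v" "ds \<noteq> []"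
      by (auto simp: circle_def)
    \<comment> \<open>The predicate \<open>walk\<close> does not itself place \<open>v\<close> in
      the graph; here the first edge of the nonempty circle does.\<close>
    then have verts: "v \<in> verts \<Phi>"
      using tail_in_verts[of "hd ds"] assms by (cases ds) auto
    have "walk \<Phi> (component_edges \<Phi> S (connection \<Phi> S `` {v})) v ds v"
      by (rule walk_component_edges[OF assms component_of_in_components[OF verts] comp(2)[OF verts] v(1)])
    with ds have "circle \<Phi> (component_edges \<Phi> S (connection \<Phi> S `` {v})) ds"
      by (auto simp: circle_def)
    with comp(1)[OF verts] show "walk_gain \<Phi> ds = 0"
      by (simp add: balanced_def)
  qed
qed

text \<open>Closing any walk from \<open>v\<close> to \<open>w\<close> with one fixed return walk
  gives gain \<open>0\<close>. All such walks, including the chosen path, therefore have the same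
  gain.\<close>

lemma path_gain_eq_walk_gain:
  assumes "balanced \<Phi> S" "S \<subseteq> edges \<Phi>" "walk \<Phi> S v ds w"
  shows "path_gain \<Phi> S v w = walk_gain \<Phi> ds"
proof -
  obtain rs where rs: "walk \<Phi> S w rs v"
    using walk_reverse[OF assms(3)] by blast
  have gain: "walk_gain \<Phi> ps = - walk_gain \<Phi> rs" if "walk \<Phi> S v ps w" for ps
  proof -
    have "walk \<Phi> S v (ps @ rs) v"
      using that rs by (auto simp: walk_append)
    then have "walk_gain \<Phi> ps + walk_gain \<Phi> rs = 0"
      using closed_walk_gain_zero[OF assms(1,2)] by fastforce
    then show ?thesis
      by (simp add: eq_neg_iff_add_eq_0)
  qed
  have "path \<Phi> S v (SOME ps. path \<Phi> S v ps w) w"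
    by (rule someI_ex[OF walk_imp_path[OF assms(3)]])
  then show ?thesis
    unfolding path_gain_def using gain assms(3) by (simp add: path_def)
qed

text \<open>Prefixing \<open>ds\<close> adds its gain on the left of every path gain out of
  \<open>w\<close>, and left translation commutes with the finite join defining
  \<open>eta\<close>.\<close>

lemma eta_walk:
  assumes "balanced \<Phi> S" "S \<subseteq> edges \<Phi>" "W \<in> components \<Phi> S" "v \<in> W" "walk \<Phi> S v ds w"
  shows "eta \<Phi> S W v = walk_gain \<Phi> ds + eta \<Phi> S W w"
proof -
  have "path_gain \<Phi> S v u = walk_gain \<Phi> ds + path_gain \<Phi> S w u" if u: "u \<in> W" for u
  proof -
    obtain ps where ps: "walk \<Phi> S w ps u"
      using walk_between_component[OF assms(3) walk_in_component[OF assms(2-5)] u] by blast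
    with assms(5) have "walk \<Phi> S v (ds @ ps) u"
      by (auto simp: walk_append)
    then show ?thesis
      using path_gain_eq_walk_gain[OF assms(1,2)] ps by fastforce
  qed
  then have "path_gain \<Phi> S v ` W = (+) (walk_gain \<Phi> ds) ` path_gain \<Phi> S w ` W"
    by (simp add: image_image)
  moreover have fin: "finite (path_gain \<Phi> S w ` W)" "path_gain \<Phi> S w ` W \<noteq> {}"
    using finite_subset[OF component_subset[OF assms(3)] finite_verts] assms(4) by auto
  ultimately show ?thesis
    unfolding eta_def using Sup_fin_add_left[OF fin] by simp
qed

section \<open>Counting vertices by edges and components\<close>

text \<open>Choose a root in each component. Sending every other vertex to the first edge of a shortest
  walk to its root is injective: two vertices sharing that edge would each be closer to the root
  than the other.\<close>

lemma card_verts_le: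
  assumes "S \<subseteq> edges \<Phi>"
  shows "card (verts \<Phi>) \<le> card S + card (components \<Phi> S)"
proof -
  define comp where "comp v = connection \<Phi> S `` {v}" for v
  \<comment> \<open>The choice depends only on the set \<open>comp v\<close>, so vertices of the
    same component get the same root.\<close>
  define root where "root v = (SOME w. w \<in> comp v)" for v
  define dist where "dist v = (LEAST n. \<exists>ds. walk \<Phi> S v ds (root v) \<and> length ds = n)" for v
  have comp_eq: "comp v = comp w" if "v \<in> verts \<Phi>" "walk \<Phi> S v ds w" for v w ds
    unfolding comp_def using that walk_in_verts[OF assms that]
    by (intro equiv_class_eq[OF equiv_connection]) (auto simp: connection_def)
  have dist_le: "dist v \<le> length ds" if "walk \<Phi> S v ds (root v)" for v ds
    unfolding dist_def using that by (intro Least_le) blast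
  have shortest: "\<exists>ds. walk \<Phi> S v ds (root v) \<and> length ds = dist v" if v: "v \<in> verts \<Phi>" for v
  proof -
    have "v \<in> comp v"
      unfolding comp_def by (rule equiv_class_self[OF equiv_connection v])
    then have "root v \<in> comp v"
      unfolding root_def by (rule someI)
    then have "\<exists>n. \<exists>ds. walk \<Phi> S v ds (root v) \<and> length ds = n"
      by (auto simp: comp_def connection_def)
    then show ?thesis
      unfolding dist_def by (rule LeastI_ex)
  qed
  have "\<exists>d ds. walk \<Phi> S v (d # ds) (root v) \<and> Suc (length ds) = dist v"
    if "v \<in> verts \<Phi>" "v \<noteq> root v" for v
    using shortest[OF that(1)] that(2) by (metis length_Cons neq_Nil_conv walk.simps(1))
  then obtain first rest where first: "walk \<Phi> S v (first v # rest v) (root v)"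
      "Suc (length (rest v)) = dist v" if "v \<in> verts \<Phi>" "v \<noteq> root v" for v
    by metis
  \<comment> \<open>Roots are tagged with their component and other vertices with an edge; in the
    disjoint sum a root and a non-root never collide.\<close>
  define f where "f v = (if v = root v then Inr (comp v) else Inl (fst (first v)))" for v
  have "inj_on f (verts \<Phi>)"
  proof (rule inj_onI)
    fix v w assume vw: "v \<in> verts \<Phi>" "w \<in> verts \<Phi>" "f v = f w"
    show "v = w"
    proof (cases "v = root v \<or> w = root w")
      case True
      then have "v = root v" "w = root w" "comp v = comp w"
        using vw(3) by (auto simp: f_def split: if_splits)
      then show ?thesis
        by (metis root_def)
    next
      case False
      show ?thesis
      proof (rule ccontr)
        assume "v \<noteq> w"
        have e: "fst (first v) = fst (first w)"
          using False vw(3) by (simp add: f_def)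
        have "tail \<Phi> (first v) = v" "tail \<Phi> (first w) = w"
          using first(1)[OF vw(1)] first(1)[OF vw(2)] False by auto
        \<comment> \<open>The same edge in the same direction would have a single tail, so
          \<open>v\<close> and \<open>w\<close> use it in opposite directions.\<close>
        moreover from this have "snd (first w) = (\<not> snd (first v))"
          using e \<open>v \<noteq> w\<close> prod_eqI[OF e] by metis
        with e have "first w = (fst (first v), \<not> snd (first v))"
          by (simp add: prod_eq_iff)
        ultimately have heads: "head \<Phi> (first v) = w" "head \<Phi> (first w) = v"
          using first(1)[OF vw(1)] False tail_flip[of \<Phi> "fst (first v)" "snd (first v)"]
            head_flip[of \<Phi> "fst (first v)" "snd (first v)"] by auto
        have "walk \<Phi> S v [first v] w"
          using first(1)[OF vw(1)] False heads by simp
        then have "root v = root w"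
          unfolding root_def by (simp only: comp_eq[OF vw(1)])
        then have "walk \<Phi> S w (rest v) (root w)" "walk \<Phi> S v (rest w) (root v)"
          using first(1)[OF vw(1)] first(1)[OF vw(2)] False heads by simp_all
        then have "dist w \<le> length (rest v)" "dist v \<le> length (rest w)"
          by (simp_all add: dist_le)
        with first(2)[OF vw(1)] first(2)[OF vw(2)] False show False
          by simp
      qed
    qed
  qed
  moreover have "f ` verts \<Phi> \<subseteq> S <+> components \<Phi> S"
  proof (rule image_subsetI)
    fix v assume "v \<in> verts \<Phi>"
    then show "f v \<in> S <+> components \<Phi> S"
      using first(1) component_of_in_components[of v \<Phi> S] by (auto simp: f_def comp_def)
  qed
  moreover have finite: "finite S"
    using assms finite_edges by (rule finite_subset)
  ultimately have "card (verts \<Phi>) \<le> card (S <+> components \<Phi> S)"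
    by (intro card_inj_on_le) (simp_all add: finite_components)
  then show ?thesis
    by (simp add: card_Plus finite finite_components)
qed

end

section \<open>List colorations\<close>

text \<open>Expand the product over \<open>A\<close> of the factors \<open>1 - 1\<close>.\<close>

lemma sum_Pow_alternating:
  assumes "finite A"
  shows "(\<Sum>S\<in>Pow A. (-1) ^ card S :: int) = (if A = {} then 1 else 0)"
proof -
  have "(\<Sum>S\<in>Pow A. (-1) ^ card S :: int) = (\<Prod>x\<in>A. 1 - 1)"
    by (subst prod_diff_conv_sum[OF assms]) simp
  also have "\<dots> = (if A = {} then 1 else 0)"
    using assms by (simp add: power_0_left)
  finally show ?thesis .
qed

section \<open>Transport of colors along improper edges\<close>

locale colored_gain_graph = gain_graph \<Phi> + fixed_point_free_right_action C act
  for \<Phi> :: "('v, 'e, 'g::lattice_group_add) pre_gain_graph"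
    and C :: "'c set" and act :: "'c \<Rightarrow> 'g \<Rightarrow> 'c"
begin

lemma act_add_uminus: "c \<in> C \<Longrightarrow> act (act c g) (- g) = c"
  using act_add[of c g "- g"] by (simp add: act_zero)

lemma act_uminus_add: "c \<in> C \<Longrightarrow> act (act c (- g)) g = c"
  using act_add[of c "- g" g] by (simp add: act_zero)

text \<open>Impropriety asks for some direction, but reversing an edge negates its gain and acting
  by \<open>- g\<close> undoes acting by \<open>g\<close>. Any one direction therefore decides. The
  action laws hold only on \<open>C\<close>, whence the condition on \<open>x\<close>.\<close>

lemma improper_edge_iff:
  assumes "x \<in> verts \<Phi> \<rightarrow> C" "fst d \<in> edges \<Phi>" "ordinary_edge \<Phi> (fst d)"
  shows "improper_edge \<Phi> act x (fst d) \<longleftrightarrow> x (head \<Phi> d) = act (x (tail \<Phi> d)) (gain \<Phi> d)"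
proof -
  obtain e b where d: "d = (e, b)" by (cases d)
  have C: "x (tail \<Phi> (e, b)) \<in> C" "x (head \<Phi> (e, b)) \<in> C"
    using assms tail_in_verts[OF assms(2,3)] head_in_verts[OF assms(2,3)] unfolding d by blast+
  have "improper_edge \<Phi> act x e \<longleftrightarrow>
      (\<exists>b. x (head \<Phi> (e, b)) = act (x (tail \<Phi> (e, b))) (gain \<Phi> (e, b)))"
    using assms(3)
    by (auto simp: improper_edge_def ordinary_edge_def d simp del: tail.simps head.simps)
  also have "\<dots> \<longleftrightarrow> x (head \<Phi> (e, b)) = act (x (tail \<Phi> (e, b))) (gain \<Phi> (e, b)) \<or>
      x (head \<Phi> (e, \<not> b)) = act (x (tail \<Phi> (e, \<not> b))) (gain \<Phi> (e, \<not> b))"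
    by (cases b) (auto simp: ex_bool_eq)
  also have "\<dots> \<longleftrightarrow> x (head \<Phi> (e, b)) = act (x (tail \<Phi> (e, b))) (gain \<Phi> (e, b))"
    using assms(2,3) C
    by (auto simp: d tail_flip head_flip gain_inverse act_add_uminus act_uminus_add
      simp del: tail.simps head.simps)
  finally show ?thesis
    unfolding d by simp
qed

lemma improper_walk:
  assumes "x \<in> verts \<Phi> \<rightarrow> C" "S \<subseteq> edges \<Phi>" "\<forall>e\<in>S. improper_edge \<Phi> act x e"
    and "v \<in> verts \<Phi>" "walk \<Phi> S v ds w"
  shows "x w = act (x v) (walk_gain \<Phi> ds)"
  using assms(4,5)
proof (induction ds arbitrary: v)
  case Nil
  then show ?case
    using act_zero[OF funcset_mem[OF assms(1)]] by simp
next
  case (Cons d ds)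
  have d: "fst d \<in> edges \<Phi>" "ordinary_edge \<Phi> (fst d)" "tail \<Phi> d = v"
    using Cons.prems assms(2) by auto
  have "x (head \<Phi> d) = act (x v) (gain \<Phi> d)"
    using improper_edge_iff[OF assms(1) d(1,2)] assms(3) Cons.prems by auto
  moreover have "x w = act (x (head \<Phi> d)) (walk_gain \<Phi> ds)"
    by (rule Cons.IH[OF head_in_verts[OF d(1,2)]]) (use Cons.prems in simp)
  moreover have "x v \<in> C"
    using assms(1) Cons.prems by blast
  ultimately show ?case
    by (simp add: act_add)
qed

text \<open>Transport around a circle returns the initial color, so the gain of the circle fixes a
  color and must be \<open>0\<close>. Half edges are never improper.\<close>

lemma improper_imp_balanced:
  assumes "x \<in> verts \<Phi> \<rightarrow> C" "S \<subseteq> edges \<Phi>" "\<forall>e\<in>S. improper_edge \<Phi> act x e"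
  shows "balanced \<Phi> S"
  unfolding balanced_def
proof (intro conjI ballI allI impI notI)
  fix e v assume "e \<in> S" "ends \<Phi> e = Half v"
  then show False
    using assms(3) by (auto simp: improper_edge_def)
next
  fix ds assume "circle \<Phi> S ds"
  then obtain v where v: "walk \<Phi> S v ds v" "ds \<noteq> []"
    by (auto simp: circle_def)
  then have verts: "v \<in> verts \<Phi>"
    using tail_in_verts[of "hd ds"] assms by (cases ds) auto
  show "walk_gain \<Phi> ds = 0"
    using improper_walk[OF assms verts v(1)] assms(1) verts
    by (intro act_fixed_point_free[of "x v"]) auto
qed

text \<open>A component is nonempty, so the intersection lies in one translated list. This makes the
  evaluation hypothesis on \<open>u\<close> applicable.\<close>

lemma contracted_weight_finite_subset:
  assumes "finite_list_weight \<Phi> C h" "W \<in> components \<Phi> S"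
  shows "finite (contracted_weight \<Phi> act h S W)" "contracted_weight \<Phi> act h S W \<subseteq> C"
proof -
  obtain v where v: "v \<in> W"
    using component_nonempty[OF assms(2)] by blast
  then have "v \<in> verts \<Phi>"
    using component_subset[OF assms(2)] by blast
  then have h: "finite (h v)" "h v \<subseteq> C"
    using assms(1) by (auto simp: finite_list_weight_def)
  have sub: "contracted_weight \<Phi> act h S W \<subseteq> (\<lambda>c. act c (eta \<Phi> S W v)) ` h v"
    using v by (auto simp: contracted_weight_def)
  then show "finite (contracted_weight \<Phi> act h S W)"
    by (rule finite_subset) (simp add: h)
  show "contracted_weight \<Phi> act h S W \<subseteq> C"
    using sub h by (auto intro: act_closed)
qed

text \<open>A coloring that is improper on a balanced set \<open>S\<close> satisfies \<open>x\<^sub>v \<eta>(v) = x\<^sub>w \<eta>(w)\<close> whenever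
  \<open>v\<close> and \<open>w\<close> lie in the same component, so it amounts to one color per component.\<close>

lemma card_improper_list_colorations:
  assumes h: "finite_list_weight \<Phi> C h" and bal: "balanced \<Phi> S" and S: "S \<subseteq> edges \<Phi>"
  shows "card {x \<in> Pi\<^sub>E (verts \<Phi>) h. \<forall>e\<in>S. improper_edge \<Phi> act x e} =
    (\<Prod>W\<in>components \<Phi> S. card (contracted_weight \<Phi> act h S W))"
proof -
  define X where "X = {x \<in> Pi\<^sub>E (verts \<Phi>) h. \<forall>e\<in>S. improper_edge \<Phi> act x e}"
  define Y where "Y = Pi\<^sub>E (components \<Phi> S) (contracted_weight \<Phi> act h S)"
  define comp where "comp v = connection \<Phi> S `` {v}" for v
  \<comment> \<open>\<open>F\<close> reads off the color of a component at an arbitrarily chosen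
    vertex; \<open>G\<close> recovers the color at \<open>v\<close> by undoing the action of
    \<open>eta\<close>.\<close>
  define F where "F x = (\<lambda>W\<in>components \<Phi> S. let v = SOME v. v \<in> W in act (x v) (eta \<Phi> S W v))" for x
  define G where "G y = (\<lambda>v\<in>verts \<Phi>. act (y (comp v)) (- eta \<Phi> S (comp v) v))" for y
  have hC: "c \<in> C" if "v \<in> verts \<Phi>" "c \<in> h v" for v c
    using h that by (auto simp: finite_list_weight_def)
  have comp: "comp v \<in> components \<Phi> S" "v \<in> comp v" if "v \<in> verts \<Phi>" for v
    using component_of_in_components[OF that] equiv_class_self[OF equiv_connection that]
    by (auto simp: comp_def)
  \<comment> \<open>The value does not depend on the chosen vertex \<open>w\<close>: color and
    \<open>eta\<close> change along a walk by the same gain, and the two changes cancel.\<close>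
  have F: "F x W = act (x v) (eta \<Phi> S W v)"
    if x: "x \<in> X" and W: "W \<in> components \<Phi> S" "v \<in> W" for x W v
  proof -
    define w where "w = (SOME w. w \<in> W)"
    have w: "w \<in> W"
      unfolding w_def using W(2) by (rule someI)
    obtain ds where ds: "walk \<Phi> S w ds v"
      using walk_between_component[OF W(1) w W(2)] by blast
    have xC: "x \<in> verts \<Phi> \<rightarrow> C"
      using x hC by (auto simp: X_def)
    have verts: "w \<in> verts \<Phi>"
      using component_subset[OF W(1)] w by blast
    have "x v = act (x w) (walk_gain \<Phi> ds)"
      using x by (intro improper_walk[OF xC S _ verts ds]) (simp add: X_def)
    moreover have "eta \<Phi> S W w = walk_gain \<Phi> ds + eta \<Phi> S W v"
      by (rule eta_walk[OF bal S W(1) w ds])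
    moreover have "x w \<in> C"
      using xC verts by blast
    ultimately have "act (x v) (eta \<Phi> S W v) = act (x w) (eta \<Phi> S W w)"
      by (simp add: act_add)
    then show ?thesis
      using W(1) by (simp add: F_def w_def Let_def)
  qed
  have YC: "y W \<in> C" if "y \<in> Y" "W \<in> components \<Phi> S" for y W
    using that contracted_weight_finite_subset(2)[OF h that(2)] by (auto simp: Y_def)
  have "bij_betw F X Y"
  proof (rule bij_betw_byWitness[where f' = G])
    show "\<forall>x\<in>X. G (F x) = x"
    proof
      fix x assume x: "x \<in> X"
      show "G (F x) = x"
      proof
        fix v
        show "G (F x) v = x v"
        proof (cases "v \<in> verts \<Phi>")
          case True
          then have "x v \<in> C"
            using x hC by (auto simp: X_def)
          with True show ?thesis
            by (simp add: G_def F[OF x comp(1)[OF True] comp(2)[OF True]] act_add_uminus)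
        next
          case False
          then show ?thesis
            using x by (auto simp: G_def X_def PiE_def extensional_def)
        qed
      qed
    qed
    have GX: "G y \<in> X" if y: "y \<in> Y" for y
    proof -
      have yv: "y (comp v) \<in> (\<lambda>c. act c (eta \<Phi> S (comp v) v)) ` h v" if v: "v \<in> verts \<Phi>" for v
        using PiE_mem[OF y[unfolded Y_def] comp(1)[OF v]] comp(2)[OF v]
        by (simp add: contracted_weight_def)
      have Gh: "G y v \<in> h v" if v: "v \<in> verts \<Phi>" for v
        using yv[OF v] v hC[OF v] by (auto simp: G_def act_add_uminus)
      moreover have "improper_edge \<Phi> act (G y) e" if e: "e \<in> S" for e
      proof (cases "ends \<Phi> e")
        case (Joins v w)
        define d where "d = (e, True)"
        have d: "fst d \<in> edges \<Phi>" "ordinary_edge \<Phi> (fst d)"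
          using e S Joins by (auto simp: d_def ordinary_edge_def)
        have verts: "v \<in> verts \<Phi>" "w \<in> verts \<Phi>"
          using d ends_in_verts[of e] Joins by (auto simp: d_def)
        have walk: "walk \<Phi> S v [d] w"
          using d e Joins by (auto simp: d_def)
        have same: "comp w = comp v"
          unfolding comp_def
          by (rule equiv_class_eq[OF equiv_connection, symmetric])
            (use verts walk in \<open>unfold connection_def, blast\<close>)
        have eta: "eta \<Phi> S (comp v) v = gain \<Phi> d + eta \<Phi> S (comp v) w"
          using eta_walk[OF bal S comp[OF verts(1)] walk] by simp
        have C: "y (comp v) \<in> C"
          by (rule YC[OF y comp(1)[OF verts(1)]])
        have "act (G y v) (gain \<Phi> d) = act (y (comp v)) (- eta \<Phi> S (comp v) v + gain \<Phi> d)"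
          using verts C by (simp add: G_def act_add)
        \<comment> \<open>With \<open>eta\<close> at \<open>v\<close> equal to the gain plus
          \<open>eta\<close> at \<open>w\<close>, negation reverses the order of the sum, and the
          gain then cancels against its negative.\<close>
        also have "\<dots> = G y w"
          using verts by (simp add: G_def same eta minus_add add.assoc)
        finally have "G y (head \<Phi> d) = act (G y (tail \<Phi> d)) (gain \<Phi> d)"
          using Joins by (simp add: d_def)
        moreover have "G y \<in> verts \<Phi> \<rightarrow> C"
          using Gh hC by auto
        ultimately show ?thesis
          using improper_edge_iff[OF _ d, of "G y"] by (simp add: d_def)
      next
        case (Half v)
        then show ?thesis
          using bal e by (auto simp: balanced_def)
      next
        case Loose
        then show ?thesis
          by (simp add: improper_edge_def)
      qed
      ultimately show ?thesis
        by (auto simp: X_def G_def)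
    qed
    then show "G ` Y \<subseteq> X" by blast
    show "F ` X \<subseteq> Y"
    proof (rule image_subsetI)
      fix x assume x: "x \<in> X"
      have "F x W \<in> contracted_weight \<Phi> act h S W" if W: "W \<in> components \<Phi> S" for W
        unfolding contracted_weight_def
      proof (rule INT_I)
        fix v assume v: "v \<in> W"
        then have "v \<in> verts \<Phi>"
          using component_subset[OF W] by blast
        then have "x v \<in> h v"
          using x by (auto simp: X_def)
        then show "F x W \<in> (\<lambda>c. act c (eta \<Phi> S W v)) ` h v"
          by (simp add: F[OF x W v])
      qed
      then show "F x \<in> Y"
        by (auto simp: Y_def F_def)
    qed
    show "\<forall>y\<in>Y. F (G y) = y"
    proof
      fix y assume y: "y \<in> Y"
      show "F (G y) = y"
      proof
        fix W
        show "F (G y) W = y W"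
        proof (cases "W \<in> components \<Phi> S")
          case True
          obtain v where v: "v \<in> W"
            using component_nonempty[OF True] by blast
          then have "v \<in> verts \<Phi>" "comp v = W"
            using component_subset[OF True] component_eq[OF True v] by (auto simp: comp_def)
          then show ?thesis
            unfolding F[OF GX[OF y] True v]
            using YC[OF y True] by (simp add: G_def act_uminus_add)
        next
          case False
          then show ?thesis
            using y by (auto simp: F_def Y_def PiE_def extensional_def)
        qed
      qed
    qed
  qed
  then have "card X = card Y"
    by (rule bij_betw_same_card)
  then show ?thesis
    by (simp add: X_def Y_def card_PiE finite_components)
qed

text \<open>Inclusion and exclusion: the indicator that \<open>x\<close> has no improper edge is the
  alternating sum over subsets of its improper edges. Exchanging the two sums groups the terms by
  edge set.\<close>

lemma card_proper_list_colorations: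
  assumes h: "finite_list_weight \<Phi> C h"
  shows "int (card (proper_list_colorations \<Phi> C act h)) =
    (\<Sum>S\<in>Pow (edges \<Phi>). (-1) ^ card S *
      int (card {x \<in> Pi\<^sub>E (verts \<Phi>) h. \<forall>e\<in>S. improper_edge \<Phi> act x e}))"
proof -
  let ?X = "Pi\<^sub>E (verts \<Phi>) h"
  let ?I = "\<lambda>x. {e \<in> edges \<Phi>. improper_edge \<Phi> act x e}"
  have fin: "finite ?X"
    using h finite_verts by (intro finite_PiE) (auto simp: finite_list_weight_def)
  have "proper_list_colorations \<Phi> C act h = {x \<in> ?X. ?I x = {}}"
    using h by (auto simp: proper_list_colorations_def finite_list_weight_def PiE_def Pi_def)
  then have "int (card (proper_list_colorations \<Phi> C act h)) = (\<Sum>x\<in>?X. if ?I x = {} then 1 else 0)"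
    using fin by (simp add: sum.If_cases Int_def)
  also have "\<dots> = (\<Sum>x\<in>?X. \<Sum>S\<in>Pow (?I x). (-1) ^ card S)"
    by (simp add: sum_Pow_alternating finite_edges)
  also have "\<dots> = (\<Sum>x\<in>?X. \<Sum>S\<in>{S \<in> Pow (edges \<Phi>). \<forall>e\<in>S. improper_edge \<Phi> act x e}. (-1) ^ card S)"
    by (intro sum.cong refl) auto
  also have "\<dots> = (\<Sum>S\<in>Pow (edges \<Phi>). \<Sum>x\<in>{x \<in> ?X. \<forall>e\<in>S. improper_edge \<Phi> act x e}. (-1) ^ card S)"
    using fin finite_edges by (intro sum.swap_restrict) simp_all
  finally show ?thesis
    by (simp add: mult.commute)
qed

end

theorem theorem5p4:
  fixes \<Phi> :: "('v, 'e, 'g::lattice_group_add) pre_gain_graph"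
    and C :: "'c set" and act :: "'c \<Rightarrow> 'g \<Rightarrow> 'c" and h :: "'v \<Rightarrow> 'c set"
    and u :: "'c set \<Rightarrow> int"
  assumes "gain_graph \<Phi>"
    and "fixed_point_free_right_action C act"
    and "finite_list_weight \<Phi> C h"
    and "\<And>k. finite k \<Longrightarrow> k \<subseteq> C \<Longrightarrow> u k = - int (card k)"
  shows "int (card (proper_list_colorations \<Phi> C act h)) =
    (-1) ^ card (verts \<Phi>) * eval_mpoly (values_at u (-1) 0) (total_dichromatic \<Phi> act h)"
proof -
  interpret colored_gain_graph \<Phi> C act
    using assms(1,2) by (simp add: colored_gain_graph_def)
  let ?n = "card (verts \<Phi>)" and ?B = "balanced_components \<Phi>" and ?K = "components \<Phi>"
  \<comment> \<open>The two sums over edge sets agree term by term.\<close>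
  have summand: "(-1) ^ card S * int (card {x \<in> Pi\<^sub>E (verts \<Phi>) h. \<forall>e\<in>S. improper_edge \<Phi> act x e}) =
      (-1) ^ ?n * ((-1) ^ (card S + card (?B S) - ?n) * 0 ^ (card (?K S) - card (?B S)) *
        (\<Prod>W\<in>?B S. u (contracted_weight \<Phi> act h S W)))" if S: "S \<subseteq> edges \<Phi>" for S
  proof (cases "balanced \<Phi> S")
    case True
    \<comment> \<open>The exponent of \<open>0\<close> becomes zero, and \<open>0 ^ 0 = 1\<close>
      keeps the term.\<close>
    then have B: "?B S = ?K S"
      using balanced_iff_all_components_balanced[OF S] by blast
    have "(\<Prod>W\<in>?K S. u (contracted_weight \<Phi> act h S W)) =
        (\<Prod>W\<in>?K S. - int (card (contracted_weight \<Phi> act h S W)))"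
      by (intro prod.cong refl assms(4) contracted_weight_finite_subset[OF assms(3)])
    then have u: "(\<Prod>W\<in>?K S. u (contracted_weight \<Phi> act h S W)) = (-1) ^ card (?K S) *
        int (card {x \<in> Pi\<^sub>E (verts \<Phi>) h. \<forall>e\<in>S. improper_edge \<Phi> act x e})"
      by (simp add: prod_uminus card_improper_list_colorations[OF assms(3) True S])
    \<comment> \<open>By \<open>card_verts_le\<close> the subtraction is exact, so \<open>?n\<close>
      cancels. The number of components then occurs twice in the exponent and leaves the sign of
      \<open>card S\<close>.\<close>
    have "(-1) ^ ?n * (-1) ^ (card S + card (?K S) - ?n) * (-1) ^ card (?K S) =
        ((-1) ^ (card S + card (?K S) + card (?K S)) :: int)"
      using card_verts_le[OF S] by (simp add: power_add[symmetric])
    also have "\<dots> = (-1) ^ card S"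
      by (simp add: power_add)
    finally show ?thesis
      by (simp add: B u mult.assoc[symmetric])
  next
    case False
    then have "?B S \<subset> ?K S"
      using balanced_iff_all_components_balanced[OF S] by (auto simp: balanced_components_def)
    \<comment> \<open>An unbalanced component makes the exponent of \<open>0\<close> positive, so
      the polynomial side vanishes.\<close>
    then have "card (?B S) < card (?K S)"
      by (rule psubset_card_mono[OF finite_components])
    moreover have "x \<in> verts \<Phi> \<rightarrow> C" if "x \<in> Pi\<^sub>E (verts \<Phi>) h" for x
      using that assms(3) by (auto simp: finite_list_weight_def)
    then have no_coloring: "{x \<in> Pi\<^sub>E (verts \<Phi>) h. \<forall>e\<in>S. improper_edge \<Phi> act x e} = {}"
      using improper_imp_balanced[OF _ S] False by blast
    ultimately show ?thesis
      unfolding no_coloring by (simp add: power_0_left)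
  qed
  show ?thesis
    unfolding card_proper_list_colorations[OF assms(3)] total_dichromatic_def
    by (simp add: eval_mpoly_sum eval_mpoly_mult eval_mpoly_power eval_mpoly_prod sum_distrib_left
      summand)
qed

end
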